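(* Let $p,q\in\mathbb{Z}$ be such that the polynomial $x^3-px-q$ is irreducible over $\mathbb{Q}$ and has exactly one real root $\theta$. Then there exists a Peck sequence for the pair $(\theta,\theta^2)$.
   Context: For $x\in\mathbb{R}$, $\|x\|$ denotes the distance from $x$ to the nearest integer. A Peck sequence for a pair $(\sigma,\tau)$ of real numbers is a strictly increasing sequence $(s_n)_{n\ge1}$ of positive integers for which there exist constants $M_1,M_2>0$ and an infinite subsequence $(\psi_n)_{n\ge1}$ of $(s_n)$ with all $\psi_n\ge 2$, such that for all $n$: $\max\{\|s_n\sigma\|,\|s_n\tau\|\}<\frac{M_1}{s_n^{1/2}}$ and $\|\psi_n\sigma\|<\frac{M_2}{\psi_n^{1/2}\log\psi_n}$. *)

theory Defs
  imports "HOL-Analysis.Analysis" "HOL-Computational_Algebra.Polynomial_Factorial"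
begin

definition dist_nint :: "real \<Rightarrow> real" where
  "dist_nint x = (INF k::int. \<bar>x - of_int k\<bar>)"

text \<open>A Peck sequence for (sigma, tau).  The infinite subsequence psi of s
  is represented as s composed with a strictly increasing index map r.\<close>
definition peck_sequence :: "real \<Rightarrow> real \<Rightarrow> (nat \<Rightarrow> nat) \<Rightarrow> bool" where
  "peck_sequence sg ta s \<longleftrightarrow>
     strict_mono s \<and> (\<forall>n. s n > 0) \<and>
     (\<exists>(M1::real) (M2::real) (r::nat\<Rightarrow>nat). M1 > 0 \<and> M2 > 0 \<and> strict_mono r \<and>
        (\<forall>n. s (r n) \<ge> 2) \<and>
        (\<forall>n. max (dist_nint (real (s n) * sg)) (dist_nint (real (s n) * ta))
                < M1 / sqrt (real (s n))) \<and>
        (\<forall>n. dist_nint (real (s (r n)) * sg)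
                < M2 / (sqrt (real (s (r n))) * ln (real (s (r n))))))"

end

theory Submission
  imports Defs
begin

text \<open>
  Let \<omega> be a nonreal root of the cubic. For \<open>x = a + b\<theta> + c\<theta>\<^sup>2\<close> with conjugate
  \<open>z = a + b\<omega> + c\<omega>\<^sup>2\<close>, the imaginary part of z is a fixed multiple of \<open>b - c\<theta>\<close>, and its real
  part is a combination of \<open>b - c\<theta>\<close> and \<open>(a + pc) - c\<theta>\<^sup>2\<close>; so if z is small, then c is the
  denominator of a good simultaneous approximation to \<open>(\<theta>, \<theta>\<^sup>2)\<close>. Dirichlet's simultaneous
  approximation theorem yields elements of bounded norm with arbitrarily small z, and two of them
  with the same norm m that are congruent modulo m have as quotient a unit \<open>x > 1\<close>, for which
  \<open>|z|\<^sup>2 = 1/x\<close>. The coefficients c of \<open>x^n\<close> grow like \<open>x^n\<close>, so the approximation quality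
  \<open>|z|^n\<close> is of order \<open>c powr (-1/2)\<close>. The error for \<theta> has the additional factor
  \<open>sin (n Arg z)\<close>, which is at most \<open>pi/n\<close>, of order \<open>1 / ln c\<close>, for infinitely many n by
  Dirichlet's theorem applied to \<open>Arg z / pi\<close>. These c alone form a Peck sequence.
\<close>

section \<open>Distance to integers, one-dimensional Dirichlet approximation, and the sine\<close>

lemma dist_nint_le: "dist_nint x \<le> \<bar>x - of_int k\<bar>"
  unfolding dist_nint_def by (rule cINF_lower) (auto intro!: bdd_belowI[of _ 0])

text \<open>Dirichlet's theorem bounds the denominator only from above, and for rational \<alpha> it
  may keep returning the same small one. Multiples of a small denominator then serve as large
  ones.\<close>

lemma exists_large_Dirichlet_denominator:
  fixes \<alpha> :: real
  assumes "N > 0"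
  shows "\<exists>n\<ge>N. \<exists>h::int. \<bar>real n * \<alpha> - of_int h\<bar> \<le> 1 / real n"
proof -
  have "N ^ 3 > 0" using assms by simp
  then obtain h k where k: "0 < k" "k \<le> int (N ^ 3)"
    and hk: "\<bar>of_int k * \<alpha> - of_int h\<bar> < 1 / real (N ^ 3)"
    by (rule Dirichlet_approx)
  obtain m where m: "k = int m" using k(1) by (metis zero_less_imp_eq_int)
  have m0: "m > 0" using k m by simp
  have mle: "m \<le> N ^ 3" using k(2) unfolding m by linarith
  show ?thesis
  proof (cases "N \<le> m")
    case True
    have "1 / real (N ^ 3) \<le> 1 / real m"
      using m0 mle by (intro frac_le) (simp_all only: of_nat_le_iff of_nat_0_less_iff)
    then show ?thesis using True hk m by (intro exI[of _ m]) (auto intro!: exI[of _ h])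
  next
    case False
    \<comment> \<open>A denominator below N is multiplied by N; the exponent 3 leaves room for this.\<close>
    have "real (m * N) * \<alpha> - of_int (int N * h) = real N * (of_int k * \<alpha> - of_int h)"
      by (simp add: m algebra_simps)
    then have "\<bar>real (m * N) * \<alpha> - of_int (int N * h)\<bar> = real N * \<bar>of_int k * \<alpha> - of_int h\<bar>"
      by (simp add: abs_mult)
    also have "\<dots> \<le> real N * (1 / real (N ^ 3))"
      using hk by (intro mult_left_mono) auto
    also have "\<dots> = 1 / real (N * N)"
      using assms by (simp add: power3_eq_cube)
    also have "\<dots> \<le> 1 / real (m * N)"
      using False m0 assms by (intro divide_left_mono) (auto intro!: mult_mono)
    finally have "\<exists>h::int. \<bar>real (m * N) * \<alpha> - of_int h\<bar> \<le> 1 / real (m * N)" by blast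
    then show ?thesis using m0 by (intro exI[of _ "m * N"]) simp
  qed
qed

text \<open>A shift by a multiple of \<open>pi\<close> changes at most the sign of the sine, and
  \<open>\<bar>sin y\<bar> \<le> \<bar>y\<bar>\<close>.\<close>

lemma abs_sin_le_abs_diff_pi: "\<bar>sin x\<bar> \<le> \<bar>x - of_int h * pi\<bar>"
proof -
  have s: "sin (of_int h * pi) = 0" by (auto simp: sin_zero_iff_int2)
  then have "\<bar>cos (of_int h * pi)\<bar> = 1"
    using sin_cos_squared_add[of "of_int h * pi"] by (auto simp: power2_eq_1_iff)
  then have "\<bar>sin (x - of_int h * pi)\<bar> = \<bar>sin x\<bar>"
    by (simp add: sin_diff abs_mult s)
  then show ?thesis using abs_sin_x_le_abs_x[of "x - of_int h * pi"] by simp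
qed

section \<open>The real and the complex embedding of \<open>Z[\<theta>]\<close>\<close>

text \<open>Dividing the cubic by \<open>x - \<theta>\<close> leaves
  \<open>x^2 + \<theta> * x + \<theta>^2 - p\<close>, of discriminant
  \<open>4 * p - 3 * \<theta>^2\<close>; \<open>disc\<close> says that its two roots are not real.
  One of them is \<omega>, and \<open>D\<close> is twice its imaginary part.\<close>

locale complex_cubic =
  fixes p q :: int and \<theta> :: real
  assumes irrational: "\<theta> \<notin> \<rat>"
    and cubic: "\<theta> ^ 3 = of_int p * \<theta> + of_int q"
    and disc: "4 * of_int p < 3 * \<theta> ^ 2"
begin

definition D where "D = sqrt (3 * \<theta> ^ 2 - 4 * of_int p)"

definition \<omega> where "\<omega> = Complex (- \<theta> / 2) (D / 2)"

definition real_emb :: "int \<Rightarrow> int \<Rightarrow> int \<Rightarrow> real"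
  where "real_emb a b c = of_int a + of_int b * \<theta> + of_int c * \<theta> ^ 2"

definition complex_emb :: "int \<Rightarrow> int \<Rightarrow> int \<Rightarrow> complex"
  where "complex_emb a b c = of_int a + of_int b * \<omega> + of_int c * \<omega> ^ 2"

text \<open>Pairs keep the two images of one element together, so that powers and quotients can be
  formed before coordinates are read off.\<close>

definition embs :: "(real \<times> complex) set"
  where "embs = {(real_emb a b c, complex_emb a b c) | a b c. True}"

text \<open>The derivative of the cubic at \<theta>, which relates c to the real embedding.\<close>

abbreviation F where "F \<equiv> 3 * \<theta> ^ 2 - of_int p"

lemma D_pos: "D > 0"
  using disc by (simp add: D_def)

lemma D_sq: "D ^ 2 = 3 * \<theta> ^ 2 - 4 * of_int p"
  using disc by (simp add: D_def)

text \<open>\<open>4 * F\<close> is the sum of \<open>9 * \<theta>^2\<close> and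
  \<open>3 * \<theta>^2 - 4 * p\<close>, both positive.\<close>

lemma F_pos: "F > 0"
proof -
  have "\<theta> \<noteq> 0" using irrational by auto
  then have "0 < \<theta> ^ 2" by simp
  then show ?thesis using disc by linarith
qed

lemma omega_sq: "\<omega> ^ 2 = - of_real \<theta> * \<omega> - of_real (\<theta> ^ 2 - of_int p)"
  using D_sq
  by (simp add: \<omega>_def complex_eq_iff Re_power2 Im_power2 power_divide)
    (simp add: power2_eq_square field_simps)

lemma omega_cubic: "\<omega> ^ 3 = of_int p * \<omega> + of_int q"
proof -
  have "(of_real (\<theta> ^ 3) :: complex) = of_real (of_int p * \<theta> + of_int q)"
    using cubic by simp
  then have *: "(of_real \<theta> :: complex) ^ 3 = of_int p * of_real \<theta> + of_int q" by simp
  have "\<omega> ^ 3 - of_int p * \<omega> - of_int q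
      = (\<omega> - of_real \<theta>) * (\<omega> ^ 2 + of_real \<theta> * \<omega> + (of_real \<theta> ^ 2 - of_int p))
        + (of_real \<theta> ^ 3 - of_int p * of_real \<theta> - of_int q)"
    by algebra
  also have "\<dots> = 0" using * omega_sq by simp
  finally show ?thesis by (simp add: algebra_simps)
qed

text \<open>Eliminating \<open>\<omega>^2\<close> by \<open>omega_sq\<close> turns the conjugate
  into \<open>(a + p * c - c * \<theta>^2) + (b - c * \<theta>) * \<omega>\<close>, whose two
  coefficients are the approximation errors for \<open>\<theta>^2\<close> and \<theta>.\<close>

lemma Im_complex_emb: "Im (complex_emb a b c) = (of_int b - of_int c * \<theta>) * D / 2"
  by (simp add: complex_emb_def omega_sq) (simp add: \<omega>_def field_simps)

lemma Re_complex_emb: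
  "Re (complex_emb a b c) =
     (of_int (a + p * c) - of_int c * \<theta> ^ 2) - (of_int b - of_int c * \<theta>) * \<theta> / 2"
  by (simp add: complex_emb_def omega_sq) (simp add: \<omega>_def field_simps power2_eq_square)

text \<open>When both errors are small, this makes \<open>c\<close> nearly
  \<open>real_emb a b c / F\<close>, which ties the size of the denominator to that of the
  element.\<close>

lemma real_emb_eq:
  "real_emb a b c = of_int c * F
     + (of_int b - of_int c * \<theta>) * \<theta> + (of_int (a + p * c) - of_int c * \<theta> ^ 2)"
  by (simp add: real_emb_def field_simps power2_eq_square)

text \<open>A vanishing imaginary part would give \<open>\<theta> = b / c\<close>.\<close>

lemma complex_emb_nonzero:
  assumes "c \<noteq> 0"
  shows "complex_emb a b c \<noteq> 0"
proof
  assume "complex_emb a b c = 0"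
  then have "Im (complex_emb a b c) = 0" by simp
  then have "of_int b - of_int c * \<theta> = 0" using D_pos by (simp add: Im_complex_emb)
  then have "\<theta> = of_int b / of_int c" using assms by (simp add: field_simps)
  then show False using irrational by auto
qed

section \<open>Multiplication and the norm\<close>

text \<open>The coordinates of a product in the basis \<open>1, \<theta>, \<theta>\<^sup>2\<close>.\<close>

definition mul0 where "mul0 a b c a' b' c' = a * a' + q * (b * c' + c * b')"
definition mul1 where "mul1 a b c a' b' c' = a * b' + b * a' + p * (b * c' + c * b') + q * c * c'"
definition mul2 where "mul2 a b c a' b' c' = a * c' + b * b' + c * a' + p * c * c'"

lemmas mul_defs = mul0_def mul1_def mul2_def

text \<open>Only the cubic relation is used, so one computation over any commutative ring covers
  both \<theta> and \<omega>.\<close>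

lemma cubic_mult_general:
  fixes t :: "'a::comm_ring_1"
  assumes "t ^ 3 = of_int p * t + of_int q"
  shows "(of_int a + of_int b * t + of_int c * t ^ 2) * (of_int a' + of_int b' * t + of_int c' * t ^ 2)
    = of_int (mul0 a b c a' b' c') + of_int (mul1 a b c a' b' c') * t
      + of_int (mul2 a b c a' b' c') * t ^ 2"
proof -
  have t4: "t ^ 4 = of_int p * t ^ 2 + of_int q * t"
  proof -
    have "t ^ 4 = t ^ 3 * t" by (simp add: eval_nat_numeral algebra_simps)
    then show ?thesis unfolding assms by (simp add: power2_eq_square algebra_simps)
  qed
  have "(of_int a + of_int b * t + of_int c * t ^ 2) * (of_int a' + of_int b' * t + of_int c' * t ^ 2)
    = of_int (a * a') + of_int (a * b' + b * a') * t + of_int (a * c' + b * b' + c * a') * t ^ 2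
      + of_int (b * c' + c * b') * t ^ 3 + of_int (c * c') * t ^ 4"
    by (simp add: eval_nat_numeral algebra_simps)
  also have "\<dots> = of_int (mul0 a b c a' b' c') + of_int (mul1 a b c a' b' c') * t
      + of_int (mul2 a b c a' b' c') * t ^ 2"
    unfolding assms t4 mul_defs by (simp add: algebra_simps)
  finally show ?thesis .
qed

lemma real_emb_mult:
  "real_emb a b c * real_emb a' b' c' =
     real_emb (mul0 a b c a' b' c') (mul1 a b c a' b' c') (mul2 a b c a' b' c')"
  unfolding real_emb_def by (rule cubic_mult_general[OF cubic])

lemma complex_emb_mult:
  "complex_emb a b c * complex_emb a' b' c' =
     complex_emb (mul0 a b c a' b' c') (mul1 a b c a' b' c') (mul2 a b c a' b' c')"
  unfolding complex_emb_def by (rule cubic_mult_general[OF omega_cubic])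

lemma embs_mult:
  assumes "(x, z) \<in> embs" "(y, w) \<in> embs"
  shows "(x * y, z * w) \<in> embs"
proof -
  obtain a b c where "x = real_emb a b c" "z = complex_emb a b c"
    using assms(1) by (auto simp: embs_def)
  moreover obtain a' b' c' where "y = real_emb a' b' c'" "w = complex_emb a' b' c'"
    using assms(2) by (auto simp: embs_def)
  ultimately show ?thesis
    unfolding embs_def by (auto simp: real_emb_mult complex_emb_mult)
qed

lemma embs_one: "(1, 1) \<in> embs"
proof -
  have "(real_emb 1 0 0, complex_emb 1 0 0) \<in> embs" unfolding embs_def by blast
  then show ?thesis by (simp add: real_emb_def complex_emb_def)
qed

lemma embs_power: "(x, z) \<in> embs \<Longrightarrow> (x ^ n, z ^ n) \<in> embs"
  by (induction n) (auto intro: embs_one embs_mult)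

text \<open>
  The coordinates of \<open>|z|\<^sup>2\<close>, the product of the two nonreal conjugates, obtained from
  \<open>\<omega> + cnj \<omega> = - \<theta>\<close> and \<open>\<omega> * cnj \<omega> = \<theta>\<^sup>2 - p\<close>.
\<close>

definition adj0 where "adj0 a b c = a\<^sup>2 + 2 * p * a * c - p * b\<^sup>2 - q * b * c + p\<^sup>2 * c\<^sup>2"
definition adj1 where "adj1 a b c = q * c\<^sup>2 - a * b"
definition adj2 where "adj2 a b c = b\<^sup>2 - a * c - p * c\<^sup>2"
text \<open>The norm of \<open>a + b * \<theta> + c * \<theta>^2\<close>: the product of all three
  conjugates is an integer because its other two coordinates vanish, by \<open>mul1_adj\<close> and
  \<open>mul2_adj\<close>.\<close>

definition nrm where
  "nrm a b c = mul0 a b c (adj0 a b c) (adj1 a b c) (adj2 a b c)"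

lemmas adj_defs = adj0_def adj1_def adj2_def

lemma mul1_adj: "mul1 a b c (adj0 a b c) (adj1 a b c) (adj2 a b c) = 0"
  unfolding mul_defs adj_defs by algebra

lemma mul2_adj: "mul2 a b c (adj0 a b c) (adj1 a b c) (adj2 a b c) = 0"
  unfolding mul_defs adj_defs by algebra

lemma real_emb_adj:
  "real_emb a b c * real_emb (adj0 a b c) (adj1 a b c) (adj2 a b c) = of_int (nrm a b c)"
  unfolding real_emb_mult mul1_adj mul2_adj nrm_def by (simp add: real_emb_def)

lemma complex_emb_adj:
  "complex_emb a b c * complex_emb (adj0 a b c) (adj1 a b c) (adj2 a b c) = of_int (nrm a b c)"
  unfolding complex_emb_mult mul1_adj mul2_adj nrm_def by (simp add: complex_emb_def)

lemma real_emb_adj_eq_cmod: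
  "real_emb (adj0 a b c) (adj1 a b c) (adj2 a b c) = cmod (complex_emb a b c) ^ 2"
proof -
  have "cmod (complex_emb a b c) ^ 2 =
      (((of_int a + of_int p * of_int c) - of_int c * \<theta> ^ 2) - (of_int b - of_int c * \<theta>) * \<theta> / 2) ^ 2
       + (of_int b - of_int c * \<theta>) ^ 2 * D ^ 2 / 4"
    unfolding cmod_power2 Re_complex_emb Im_complex_emb by (simp add: power_divide power_mult_distrib)
  also have "\<dots> = real_emb (adj0 a b c) (adj1 a b c) (adj2 a b c)"
    using cubic unfolding D_sq real_emb_def adj_defs of_int_add of_int_diff of_int_mult of_int_power of_int_numeral
    by algebra
  finally show ?thesis ..
qed

lemma nrm_eq: "of_int (nrm a b c) = real_emb a b c * cmod (complex_emb a b c) ^ 2"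
  using real_emb_adj[of a b c] by (simp add: real_emb_adj_eq_cmod)

section \<open>Construction of a unit\<close>

text \<open>Simultaneous approximation of \<theta> and \<open>\<theta>^2\<close> with errors below
  \<open>1 / N\<close> has a denominator \<open>c \<le> N^2\<close>. Hence the real embedding is
  \<open>O(N^2)\<close>, the complex one is \<open>O(1 / N)\<close>, and \<open>N\<close> cancels in
  the norm.\<close>

lemma exists_small_bounded_norm:
  "\<exists>K. \<forall>\<delta>>0. \<exists>a b c. c \<noteq> 0 \<and> real_emb a b c > 0 \<and> cmod (complex_emb a b c) < \<delta>
      \<and> real_emb a b c * cmod (complex_emb a b c) ^ 2 \<le> K"
proof (rule exI[of _ "(F + (\<bar>\<theta>\<bar> + 1)) * ((\<bar>\<theta>\<bar> + 1) + D) ^ 2"], intro allI impI)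
  fix \<delta> :: real assume \<delta>: "\<delta> > 0"
  define L where "L = \<bar>\<theta>\<bar> + 1"
  have L: "L > 0" by (simp add: L_def)
  \<comment> \<open>The first bound keeps the errors below \<open>F \<le> c * F\<close>, so that the
    real embedding is positive; the second makes the complex one smaller than \<delta>.\<close>
  obtain N :: nat where N: "real N > max (L / F) ((L + D) / \<delta>)"
    using reals_Archimedean2 by blast
  have LF: "L / F > 0" using L F_pos by simp
  have N0: "N > 0" using N LF by (cases N) auto
  have N1: "L / N < F" using N F_pos N0 by (simp add: field_simps)
  have N2: "(L + D) / N < \<delta>" using N \<delta> N0 by (simp add: field_simps)
  obtain c d where c: "0 < c" "c \<le> int (N ^ 2)"
    and d: "\<And>i. i < 2 \<Longrightarrow> \<bar>of_int c * (\<theta> ^ Suc i) - of_int (d i)\<bar> < 1 / N"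
    by (rule Dirichlet_approx_simult[OF N0, of 2 "\<lambda>i. \<theta> ^ Suc i"]) blast
  \<comment> \<open>The shift by \<open>p * c\<close> makes \<open>d 1\<close> the integer nearest
    in role to \<open>c * \<theta>^2\<close> in \<open>Re_complex_emb\<close>.\<close>
  define b a where "b = d 0" and "a = d 1 - p * c"
  define e1 where "e1 = of_int b - of_int c * \<theta>"
  define e2 where "e2 = of_int (a + p * c) - of_int c * \<theta> ^ 2"
  have e1: "\<bar>e1\<bar> \<le> 1 / N" using d[of 0] by (simp add: e1_def b_def)
  have e2: "\<bar>e2\<bar> \<le> 1 / N" using d[of 1] by (simp add: e2_def a_def power2_eq_square)
  have e1t: "\<bar>e1 * \<theta>\<bar> \<le> \<bar>\<theta>\<bar> / N"
    using mult_right_mono[OF e1, of "\<bar>\<theta>\<bar>"] by (simp add: abs_mult)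
  have e1D: "\<bar>e1 * D\<bar> \<le> D / N"
    using mult_right_mono[OF e1, of D] D_pos by (simp add: abs_mult)
  have LN: "L / N = \<bar>\<theta>\<bar> / N + 1 / N" by (simp add: L_def add_divide_distrib)
  have x: "real_emb a b c = of_int c * F + e1 * \<theta> + e2"
    by (simp add: real_emb_eq e1_def e2_def)
  have cF: "F \<le> of_int c * F" using c F_pos mult_right_mono[of 1 "of_int c" F] by simp
  have xpos: "real_emb a b c > 0"
    using x e1t e2 cF N1 LN by linarith
  have "of_int c \<le> real N ^ 2" 
    using c(2) of_int_le_iff[of c "int (N ^ 2)", where ?'a = real] by simp
  then have cF2: "of_int c * F \<le> real N ^ 2 * F" using F_pos by (intro mult_right_mono) auto
  have "L / N \<le> real N ^ 2 * L"
  proof -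
    have "L * 1 \<le> L * (real N ^ 2 * real N)" using L N0 mult_mono[of 1 "real N ^ 2" 1 "real N"]
      by (intro mult_left_mono) (auto simp: one_le_power)
    then show ?thesis using N0 by (simp add: field_simps)
  qed
  then have xle: "real_emb a b c \<le> real N ^ 2 * (F + L)"
    using x e1t e2 cF2 LN unfolding distrib_left by linarith
  have "cmod (complex_emb a b c) \<le> \<bar>Re (complex_emb a b c)\<bar> + \<bar>Im (complex_emb a b c)\<bar>"
    by (rule cmod_le)
  also have "\<dots> = \<bar>e2 - e1 * \<theta> / 2\<bar> + \<bar>e1 * D\<bar> / 2"
    by (simp add: Re_complex_emb Im_complex_emb e1_def e2_def)
  also have "\<dots> \<le> (L + D) / N"
    unfolding add_divide_distrib LN using e1t e1D e2 by linarith
  finally have zle: "cmod (complex_emb a b c) \<le> (L + D) / N" .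
  have "real_emb a b c * cmod (complex_emb a b c) ^ 2 \<le> (real N ^ 2 * (F + L)) * ((L + D) / N) ^ 2"
    using xle zle xpos L F_pos by (intro mult_mono power_mono) auto
  also have "\<dots> = (F + L) * (L + D) ^ 2"
    using N0 by (simp add: power_divide)
  finally show "\<exists>a b c. c \<noteq> 0 \<and> real_emb a b c > 0 \<and> cmod (complex_emb a b c) < \<delta>
      \<and> real_emb a b c * cmod (complex_emb a b c) ^ 2
        \<le> (F + (\<bar>\<theta>\<bar> + 1)) * ((\<bar>\<theta>\<bar> + 1) + D) ^ 2"
    using c(1) xpos le_less_trans[OF zle N2] unfolding L_def
    by (intro exI[of _ a] exI[of _ b] exI[of _ c] conjI) simp_all
qed

text \<open>An element divides its norm \<open>m\<close>, the cofactor being its adjoint. It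
  therefore divides every element congruent to it modulo \<open>m\<close>.\<close>

lemma quotient_in_embs:
  assumes m: "m = nrm a b c" "m \<noteq> 0"
    and "a' mod m = a mod m" "b' mod m = b mod m" "c' mod m = c mod m"
  shows "(real_emb a' b' c' / real_emb a b c, complex_emb a' b' c' / complex_emb a b c) \<in> embs"
proof -
  obtain u v w where uvw: "a' = a + m * u" "b' = b + m * v" "c' = c + m * w"
    using assms(3-5) by (metis mod_eqE)
  define A B C where "A = adj0 a b c" and "B = adj1 a b c" and "C = adj2 a b c"
  define k l n where "k = mul0 u v w A B C" and "l = mul1 u v w A B C" and "n = mul2 u v w A B C"
  have r: "real_emb a b c * real_emb A B C = of_int m"
    unfolding A_def B_def C_def m by (rule real_emb_adj)
  have z: "complex_emb a b c * complex_emb A B C = of_int m"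
    unfolding A_def B_def C_def m by (rule complex_emb_adj)
  have "real_emb a' b' c' = real_emb a b c + of_int m * real_emb u v w"
    by (simp add: uvw real_emb_def algebra_simps)
  also have "\<dots> = real_emb a b c * (1 + real_emb u v w * real_emb A B C)"
    unfolding r[symmetric] by (simp add: algebra_simps)
  also have "1 + real_emb u v w * real_emb A B C = real_emb (1 + k) l n"
    unfolding real_emb_mult k_def l_def n_def by (simp add: real_emb_def)
  finally have 1: "real_emb a' b' c' / real_emb a b c = real_emb (1 + k) l n"
    using r m(2) by auto
  have "complex_emb a' b' c' = complex_emb a b c + of_int m * complex_emb u v w"
    by (simp add: uvw complex_emb_def algebra_simps)
  also have "\<dots> = complex_emb a b c * (1 + complex_emb u v w * complex_emb A B C)"
    unfolding z[symmetric] by (simp add: algebra_simps)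
  also have "1 + complex_emb u v w * complex_emb A B C = complex_emb (1 + k) l n"
    unfolding complex_emb_mult k_def l_def n_def by (simp add: complex_emb_def)
  finally have 2: "complex_emb a' b' c' / complex_emb a b c = complex_emb (1 + k) l n"
    using z m(2) by auto
  show ?thesis unfolding 1 2 embs_def by blast
qed

lemma exists_unit:
  obtains x z where "(x, z) \<in> embs" "x > 1" "x * cmod z ^ 2 = 1"
proof -
  obtain K where K: "\<And>\<delta>. \<delta> > 0 \<Longrightarrow> \<exists>a b c. c \<noteq> 0 \<and> real_emb a b c > 0 \<and>
      cmod (complex_emb a b c) < \<delta> \<and> real_emb a b c * cmod (complex_emb a b c) ^ 2 \<le> K"
    using exists_small_bounded_norm by metis
  define X where "X = (\<lambda>(a, b, c). real_emb a b c)"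
  define Z where "Z = (\<lambda>(a, b, c). complex_emb a b c)"
  define N where "N = (\<lambda>(a, b, c). nrm a b c)"
  define good where "good t \<longleftrightarrow> Z t \<noteq> 0 \<and> X t > 0 \<and> X t * cmod (Z t) ^ 2 \<le> K" for t
  have ex: "\<exists>t. good t \<and> cmod (Z t) < \<delta>" if \<delta>: "\<delta> > 0" for \<delta>
  proof -
    obtain a b c where "c \<noteq> 0" "real_emb a b c > 0" "cmod (complex_emb a b c) < \<delta>"
      "real_emb a b c * cmod (complex_emb a b c) ^ 2 \<le> K" using K[OF \<delta>] by blast
    then show ?thesis
      by (intro exI[of _ "(a, b, c)"]) (auto simp: good_def X_def Z_def complex_emb_nonzero)
  qed
  \<comment> \<open>Strict decrease of the complex absolute value later decides which of two
    elements of equal norm has the larger real embedding.\<close>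
  have "\<exists>f. \<forall>n. good (f n) \<and> cmod (Z (f (Suc n))) < cmod (Z (f n))"
  proof (rule dependent_nat_choice)
    show "\<exists>t. good t" using ex[of 1] by auto
    fix t assume "good t"
    then show "\<exists>t'. good t' \<and> cmod (Z t') < cmod (Z t)"
      using ex[of "cmod (Z t)"] by (auto simp: good_def)
  qed
  then obtain f where f: "\<And>n. good (f n)" "\<And>n. cmod (Z (f (Suc n))) < cmod (Z (f n))" by blast
  have dec: "cmod (Z (f j)) < cmod (Z (f i))" if "i < j" for i j
    using lift_Suc_mono_less[of "\<lambda>n. - cmod (Z (f n))" i j] f(2) that by simp
  have NX: "of_int (N t) = X t * cmod (Z t) ^ 2" for t
    by (cases t) (simp add: N_def X_def Z_def nrm_eq)
  have Npos: "N (f n) > 0" for n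
  proof -
    have "real_of_int (N (f n)) > 0" using f(1)[of n] unfolding NX good_def by simp
    then show ?thesis by simp
  qed
  have NK: "N (f n) \<le> \<lfloor>K\<rfloor>" for n
    using f(1)[of n] by (simp add: good_def le_floor_iff NX)
  \<comment> \<open>Pigeonhole key: the norm and the coordinates modulo it. Norms lie between 1 and
    \<open>\<lfloor>K\<rfloor>\<close>, so only finitely many keys occur.\<close>
  define g where "g n = (case f n of (a, b, c) \<Rightarrow>
    (N (f n), a mod N (f n), b mod N (f n), c mod N (f n)))" for n
  have "range g \<subseteq> {0..\<lfloor>K\<rfloor>} \<times> {0..\<lfloor>K\<rfloor>} \<times> {0..\<lfloor>K\<rfloor>} \<times> {0..\<lfloor>K\<rfloor>}"
  proof
    fix y assume "y \<in> range g"
    then obtain n where y: "y = g n" by blast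
    have md: "0 \<le> i mod N (f n)" "i mod N (f n) \<le> \<lfloor>K\<rfloor>" for i
      using Npos[of n] NK[of n] pos_mod_bound[of "N (f n)" i] pos_mod_sign[of "N (f n)" i] by linarith+
    show "y \<in> {0..\<lfloor>K\<rfloor>} \<times> {0..\<lfloor>K\<rfloor>} \<times> {0..\<lfloor>K\<rfloor>} \<times> {0..\<lfloor>K\<rfloor>}"
      using md Npos[of n] NK[of n] unfolding y g_def by (auto split: prod.split)
  qed
  then have "finite (range g)" by (rule finite_subset) auto
  then have "\<not> inj g" using finite_imageD[of g UNIV] by auto
  then obtain i j where ij: "i < j" "g i = g j"
    unfolding inj_def by (metis linorder_neqE_nat)
  obtain a b c where fi: "f i = (a, b, c)" by (cases "f i")
  obtain a' b' c' where fj: "f j = (a', b', c')" by (cases "f j")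
  have mods: "N (f i) = N (f j)" "a' mod N (f i) = a mod N (f i)"
    "b' mod N (f i) = b mod N (f i)" "c' mod N (f i) = c mod N (f i)"
    using ij(2) by (auto simp: g_def fi fj)
  have "N (f i) = nrm a b c" by (simp add: N_def fi)
  from quotient_in_embs[OF this _ mods(2-4)] Npos[of i]
  have in_embs: "(X (f j) / X (f i), Z (f j) / Z (f i)) \<in> embs"
    by (simp add: X_def Z_def fi fj)
  have pos: "X (f i) > 0" "X (f j) > 0" "cmod (Z (f i)) > 0" "cmod (Z (f j)) > 0"
    using f(1) by (auto simp: good_def)
  have eq: "X (f j) * cmod (Z (f j)) ^ 2 = X (f i) * cmod (Z (f i)) ^ 2"
    using mods(1) by (simp flip: NX)
  then have unit: "X (f j) / X (f i) * cmod (Z (f j) / Z (f i)) ^ 2 = 1"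
    using pos by (simp add: norm_divide field_simps)
  \<comment> \<open>The norms agree, so a smaller complex factor forces a larger real one.\<close>
  have "X (f j) / X (f i) > 1"
  proof (rule ccontr)
    assume "\<not> ?thesis"
    then have "X (f j) \<le> X (f i)" using pos by simp
    moreover have "cmod (Z (f j)) ^ 2 < cmod (Z (f i)) ^ 2"
      using dec[OF ij(1)] by (intro power_strict_mono) auto
    ultimately have "X (f j) * cmod (Z (f j)) ^ 2 < X (f i) * cmod (Z (f i)) ^ 2"
      using pos by (intro mult_le_less_imp_less) auto
    then show False using eq by simp
  qed
  then show thesis using in_embs unit that by blast
qed

section \<open>Approximations from powers of the unit\<close>

lemma exists_large_peck_term:
  obtains M where "M > 0"
    "\<And>B. \<exists>s>B. 2 \<le> s \<and> dist_nint (real s * \<theta>) < M / (sqrt (real s) * ln (real s))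
        \<and> dist_nint (real s * \<theta>) < M / sqrt (real s)
        \<and> dist_nint (real s * \<theta> ^ 2) < M / sqrt (real s)"
proof -
  obtain x z where u: "(x, z) \<in> embs" "x > 1" "x * cmod z ^ 2 = 1" by (rule exists_unit)
  define r where "r = cmod z"
  define \<phi> where "\<phi> = Arg z"
  have z: "z = of_real r * cis \<phi>" by (simp add: r_def \<phi>_def flip: rcis_def rcis_cmod_Arg)
  have r0: "r > 0" using u(3) by (auto simp: r_def)
  have r1: "r \<le> 1"
  proof (rule ccontr)
    assume "\<not> ?thesis"
    then have "1 < x * r ^ 2" using u(2) by (intro less_1_mult) auto
    then show False using u(3) by (simp add: r_def)
  qed
  \<comment> \<open>\<open>H * r ^ n\<close> will bound both errors \<open>e1\<close> and
    \<open>e2\<close>, and \<open>G\<close> will bound \<open>e1 * \<theta> + e2\<close>.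
    \<open>K\<close> gives \<open>s \<le> K * x ^ n\<close> and \<open>J\<close> gives
    \<open>ln s \<le> n * J\<close>.\<close>
  define H where "H = 2 / D + \<bar>\<theta>\<bar> / D + 1"
  have H: "H \<ge> 1" "2 / D \<le> H" using D_pos by (auto simp: H_def)
  define G where "G = H * (\<bar>\<theta>\<bar> + 1)"
  have G: "G \<ge> 1" using mult_mono[of 1 H 1 "\<bar>\<theta>\<bar> + 1"] H by (simp add: G_def)
  define K where "K = (1 + G) / F + 1"
  have K: "K \<ge> 1" using G F_pos by (simp add: K_def)
  define J where "J = ln K + ln x"
  have J: "J > 0" using K u(2) unfolding J_def by (simp add: add_nonneg_pos)
  \<comment> \<open>Large enough for the bounds with and without the logarithm at once.\<close>
  define M where "M = H * sqrt K * (pi * J + 1) + 1"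
  have M1: "H * sqrt K < M" and M2: "H * sqrt K * pi * J < M"
    using H K J by (auto simp: M_def algebra_simps intro: add_nonneg_pos)
  have M0: "M > 0" using le_less_trans[OF mult_nonneg_nonneg M1] H(1) K by simp
  have "\<exists>s>B. 2 \<le> s \<and> dist_nint (real s * \<theta>) < M / (sqrt (real s) * ln (real s))
        \<and> dist_nint (real s * \<theta>) < M / sqrt (real s)
        \<and> dist_nint (real s * \<theta> ^ 2) < M / sqrt (real s)" for B
  proof -
    \<comment> \<open>As \<open>c * F\<close> differs from \<open>x ^ n\<close> by at most
      \<open>G\<close>, this size forces \<open>c > B + 2\<close>.\<close>
    obtain N where N: "x ^ N > (real B + 2) * F + G"
      using real_arch_pow[OF u(2)] by blast
    \<comment> \<open>\<open>Suc N\<close> instead of \<open>N\<close> guarantees a positive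
      denominator.\<close>
    obtain n h where n: "n \<ge> Suc N" and h: "\<bar>real n * (\<phi> / pi) - of_int h\<bar> \<le> 1 / real n"
      using exists_large_Dirichlet_denominator[of "Suc N" "\<phi> / pi"] by auto
    have n0: "n > 0" using n by simp
    have xn: "x ^ n > (real B + 2) * F + G"
      using N power_increasing[of N n x] n u(2) by linarith
    obtain a b c where abc: "x ^ n = real_emb a b c" "z ^ n = complex_emb a b c"
      using embs_power[OF u(1), of n] by (auto simp: embs_def)
    define e1 where "e1 = of_int b - of_int c * \<theta>"
    define e2 where "e2 = of_int (a + p * c) - of_int c * \<theta> ^ 2"
    have zn: "z ^ n = of_real (r ^ n) * cis (real n * \<phi>)"
      unfolding z by (simp add: power_mult_distrib Complex.DeMoivre)
    have e1: "e1 = 2 / D * Im (z ^ n)" using D_pos by (simp add: abc Im_complex_emb e1_def)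
    have e2: "e2 = Re (z ^ n) + \<theta> / D * Im (z ^ n)"
      using D_pos by (simp add: abc Im_complex_emb Re_complex_emb e1_def e2_def)
    have Im_le: "\<bar>Im (z ^ n)\<bar> \<le> r ^ n" and Re_le: "\<bar>Re (z ^ n)\<bar> \<le> r ^ n"
      using abs_Im_le_cmod[of "z ^ n"] abs_Re_le_cmod[of "z ^ n"] by (auto simp: norm_power r_def)
    have "\<bar>sin (real n * \<phi>)\<bar> \<le> \<bar>real n * \<phi> - of_int h * pi\<bar>"
      by (rule abs_sin_le_abs_diff_pi)
    also have "real n * \<phi> - of_int h * pi = pi * (real n * (\<phi> / pi) - of_int h)"
      by (simp add: field_simps)
    also have "\<bar>\<dots>\<bar> \<le> pi * (1 / real n)"
      using h by (simp add: abs_mult mult_left_mono del: times_divide_eq_right)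
    finally have sin_le: "\<bar>sin (real n * \<phi>)\<bar> \<le> pi / real n" by simp
    have rn: "0 < r ^ n" "r ^ n \<le> 1" using r0 r1 by (auto simp: power_le_one)
    have Im_le': "\<bar>Im (z ^ n)\<bar> \<le> r ^ n * (pi / real n)"
      unfolding zn using mult_left_mono[OF sin_le, of "r ^ n"] rn by (simp add: abs_mult)
    have e1_le: "\<bar>e1\<bar> \<le> H * r ^ n"
      unfolding e1 abs_mult using Im_le H D_pos by (intro mult_mono) auto
    have e1_le': "\<bar>e1\<bar> \<le> H * (r ^ n * (pi / real n))"
      unfolding e1 abs_mult using Im_le' H D_pos by (intro mult_mono) auto
    have "\<bar>e2\<bar> \<le> \<bar>Re (z ^ n)\<bar> + \<bar>\<theta>\<bar> / D * \<bar>Im (z ^ n)\<bar>"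
      unfolding e2 using D_pos abs_triangle_ineq[of "Re (z ^ n)" "\<theta> / D * Im (z ^ n)"]
      by (simp add: abs_mult)
    also have "\<dots> \<le> r ^ n + \<bar>\<theta>\<bar> / D * r ^ n"
      using Im_le Re_le D_pos by (intro add_mono mult_left_mono) auto
    also have "\<dots> \<le> H * r ^ n" using rn D_pos by (simp add: H_def algebra_simps)
    finally have e2_le: "\<bar>e2\<bar> \<le> H * r ^ n" .
    have cF: "of_int c * F = x ^ n - (e1 * \<theta> + e2)"
      unfolding abc real_emb_eq e1_def e2_def by simp
    have "\<bar>e1 * \<theta> + e2\<bar> \<le> \<bar>e1\<bar> * \<bar>\<theta>\<bar> + \<bar>e2\<bar>"
      by (metis abs_mult abs_triangle_ineq)
    also have "\<dots> \<le> H * \<bar>\<theta>\<bar> + H"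
    proof -
      have "H * r ^ n \<le> H" using mult_left_mono[of "r ^ n" 1 H] H rn by simp
      then show ?thesis using e1_le e2_le by (intro add_mono mult_right_mono) linarith+
    qed
    also have "\<dots> = G" by (simp add: G_def algebra_simps)
    finally have err: "\<bar>e1 * \<theta> + e2\<bar> \<le> G" .
    have "(real B + 2) * F < of_int c * F" using cF err xn by linarith
    then have cB: "real B + 2 < of_int c" using F_pos by simp
    define s where "s = nat c"
    have s: "real s = of_int c" using cB by (simp add: s_def)
    have sB: "s > B" "s \<ge> 2" using cB unfolding s[symmetric] by linarith+
    have xn1: "1 \<le> x ^ n" using u(2) by (simp add: one_le_power)
    have "of_int c * F \<le> (1 + G) * x ^ n"
    proof -
      have "G \<le> G * x ^ n" using mult_left_mono[OF xn1, of G] G by simp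
      then show ?thesis unfolding cF distrib_right mult_1 using err by linarith
    qed
    then have "real s \<le> (1 + G) / F * x ^ n" using F_pos unfolding s by (simp add: field_simps)
    also have "\<dots> \<le> K * x ^ n" using xn1 by (intro mult_right_mono) (auto simp: K_def)
    finally have sle: "real s \<le> K * x ^ n" .
    \<comment> \<open>The unit relation gives \<open>r ^ n = x powr (- n / 2)\<close>; against
      \<open>s \<le> K * x ^ n\<close> this yields an error of order
      \<open>1 / sqrt s\<close>.\<close>
    have "x ^ n * (r ^ n) ^ 2 = 1"
    proof -
      have "x ^ n * (r ^ n) ^ 2 = (x * r ^ 2) ^ n"
        by (simp add: power_mult_distrib mult.commute flip: power_mult)
      then show ?thesis using u(3) by (simp add: r_def)
    qed
    then have "real s * (r ^ n) ^ 2 \<le> K"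
      using mult_right_mono[OF sle, of "(r ^ n) ^ 2"] by (simp add: mult.assoc)
    then have "sqrt (real s * (r ^ n) ^ 2) \<le> sqrt K" by simp
    then have rs: "sqrt (real s) * r ^ n \<le> sqrt K" using rn by (simp add: real_sqrt_mult)
    have sq0: "sqrt (real s) > 0" using sB by simp
    have ln0: "ln (real s) > 0" using sB by simp
    \<comment> \<open>The logarithm grows at most linearly in \<open>n\<close>, so the factor
      \<open>pi / n\<close> from the sine absorbs it.\<close>
    have "ln (real s) \<le> ln (K * x ^ n)" using sle sB K u(2) by (subst ln_le_cancel_iff) auto
    also have "\<dots> = ln K + real n * ln x" using K u(2) by (simp add: ln_mult ln_realpow)
    also have "\<dots> \<le> real n * J"
      using n0 K mult_right_mono[of 1 "real n" "ln K"] by (simp add: J_def algebra_simps)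
    finally have lns: "ln (real s) \<le> real n * J" .
    have main: "H * r ^ n < M / sqrt (real s)"
    proof -
      have "H * r ^ n * sqrt (real s) \<le> H * sqrt K"
        using mult_left_mono[OF rs, of H] H by (simp add: algebra_simps)
      then show ?thesis using M1 sq0 by (simp add: field_simps)
    qed
    have d1: "dist_nint (real s * \<theta>) \<le> \<bar>e1\<bar>"
      using dist_nint_le[of "real s * \<theta>" b] by (simp add: s e1_def abs_minus_commute)
    have d2: "dist_nint (real s * \<theta> ^ 2) \<le> \<bar>e2\<bar>"
      using dist_nint_le[of "real s * \<theta> ^ 2" "a + p * c"] by (simp add: s e2_def abs_minus_commute)
    have "H * (r ^ n * (pi / real n)) < M / (sqrt (real s) * ln (real s))"
    proof -
      have "H * (r ^ n * (pi / real n)) * (sqrt (real s) * ln (real s))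
          = H * pi * ((sqrt (real s) * r ^ n) * (ln (real s) / real n))"
        by simp
      also have "\<dots> \<le> H * pi * (sqrt K * J)"
        using rs lns n0 H K J ln0 rn
        by (intro mult_left_mono mult_mono) (auto simp: field_simps)
      also have "\<dots> < M" using M2 by (simp add: algebra_simps)
      finally show ?thesis using sq0 ln0 by (subst pos_less_divide_eq) auto
    qed
    then show ?thesis
      using sB d1 d2 e1_le e1_le' e2_le main by (intro exI[of _ s]) linarith
  qed
  then show thesis using M0 that by blast
qed

lemma exists_peck_sequence: "\<exists>s. peck_sequence \<theta> (\<theta> ^ 2) s"
proof -
  obtain M where M: "M > 0"
    "\<And>B. \<exists>s>B. 2 \<le> s \<and> dist_nint (real s * \<theta>) < M / (sqrt (real s) * ln (real s))
        \<and> dist_nint (real s * \<theta>) < M / sqrt (real s)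
        \<and> dist_nint (real s * \<theta> ^ 2) < M / sqrt (real s)"
    by (rule exists_large_peck_term) blast
  define S where "S = {s::nat. 2 \<le> s \<and> dist_nint (real s * \<theta>) < M / (sqrt (real s) * ln (real s))
        \<and> dist_nint (real s * \<theta>) < M / sqrt (real s)
        \<and> dist_nint (real s * \<theta> ^ 2) < M / sqrt (real s)}"
  have inf: "infinite S"
    using M(2) unfolding infinite_nat_iff_unbounded S_def by blast
  have "enumerate S n \<in> S" for n using inf by (rule enumerate_in_set)
  then have en: "2 \<le> enumerate S n"
    "dist_nint (real (enumerate S n) * \<theta>) <
       M / (sqrt (real (enumerate S n)) * ln (real (enumerate S n)))"
    "dist_nint (real (enumerate S n) * \<theta>) < M / sqrt (real (enumerate S n))"
    "dist_nint (real (enumerate S n) * \<theta> ^ 2) < M / sqrt (real (enumerate S n))" for n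
    by (auto simp: S_def)
  have "0 < enumerate S n" for n using en(1)[of n] by simp
  \<comment> \<open>Every term satisfies the logarithmic bound, so the subsequence is the whole
    sequence, with \<open>id\<close> as index map.\<close>
  then have "peck_sequence \<theta> (\<theta> ^ 2) (enumerate S)"
    unfolding peck_sequence_def
    using M(1) en strict_mono_enumerate[OF inf]
    by (intro conjI exI[of _ M] exI[of _ id] allI) (simp_all add: strict_mono_id)
  then show ?thesis by blast
qed

end

section \<open>From irreducibility and a single real root to the locale assumptions\<close>

lemma of_rat_poly: "(of_rat (poly f r) :: real) = poly (map_poly of_rat f) (of_rat r)"
  by (induction f) (auto simp: map_poly_pCons of_rat_add of_rat_mult)

text \<open>A rational root would split off a linear factor, and the degree bound keeps the cofactor
  from being a unit.\<close>

lemma root_irrational_of_irreducible: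
  fixes f :: "rat poly"
  assumes "irreducible f" "degree f > 1"
    and "poly (map_poly of_rat f) (x::real) = 0"
  shows "x \<notin> \<rat>"
proof
  assume "x \<in> \<rat>"
  then obtain r where "x = of_rat r" by (auto elim: Rats_cases)
  then have "of_rat (poly f r) = (0::real)" using assms(3) by (simp add: of_rat_poly)
  then have "[:- r, 1:] dvd f" by (simp add: poly_eq_0_iff_dvd)
  then obtain g where g: "f = [:- r, 1:] * g" by (elim dvdE)
  have "f \<noteq> 0" using assms(2) by auto
  then have "g \<noteq> 0" using g by auto
  have "degree f = 1 + degree g"
    unfolding g using \<open>g \<noteq> 0\<close> by (subst degree_mult_eq) auto
  then have "degree g \<noteq> 0" using assms(2) by simp
  then have "\<not> g dvd 1" using \<open>g \<noteq> 0\<close> by (auto simp: is_unit_iff_degree)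
  moreover have "\<not> [:- r, 1:] dvd (1 :: rat poly)" by (auto simp: is_unit_iff_degree)
  ultimately show False using irreducibleD[OF assms(1) g] by blast
qed

theorem theorem1:
  fixes p q :: int and \<theta> :: real
  assumes irr: "irreducible ([:- of_int q, - of_int p, 0, 1:] :: rat poly)"
    and one_root: "{x :: real. x ^ 3 - of_int p * x - of_int q = 0} = {\<theta>}"
  shows "\<exists>s. peck_sequence \<theta> (\<theta> ^ 2) s"
proof -
  have root: "x ^ 3 - of_int p * x - of_int q = 0 \<longleftrightarrow> x = \<theta>" for x :: real
    using one_root by blast
  then have th: "\<theta> ^ 3 = of_int p * \<theta> + of_int q" by (simp add: algebra_simps)
  have "poly (map_poly of_rat ([:- of_int q, - of_int p, 0, 1:] :: rat poly)) \<theta> = 0"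
    using th by (simp add: map_poly_pCons of_rat_minus algebra_simps power3_eq_cube)
  then have irrational: "\<theta> \<notin> \<rat>"
    by (rule root_irrational_of_irreducible[OF irr, rotated]) simp
  have "4 * of_int p < 3 * \<theta> ^ 2"
  proof (rule ccontr)
    assume neg: "\<not> ?thesis"
    \<comment> \<open>With a nonnegative discriminant the quadratic cofactor has the real roots
      \<open>(- \<theta> + d) / 2\<close> and \<open>(- \<theta> - d) / 2\<close>. Both must equal
      \<theta>, and their sum \<open>- \<theta> = 2 * \<theta>\<close> forces
      \<open>\<theta> = 0\<close>.\<close>
    define d where "d = sqrt (4 * of_int p - 3 * \<theta> ^ 2)"
    have d: "d ^ 2 = 4 * of_int p - 3 * \<theta> ^ 2"
      using neg by (simp add: d_def)
    have "x = \<theta>" if "x = (- \<theta> + d) / 2 \<or> x = (- \<theta> - d) / 2" for x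
    proof -
      \<comment> \<open>The factor 4 completes the square: the left side is
        \<open>(2 * x + \<theta>)^2 - d^2\<close>.\<close>
      have "4 * (x ^ 2 + \<theta> * x + \<theta> ^ 2 - of_int p) = 0"
      proof -
        have "2 * x + \<theta> = d \<or> 2 * x + \<theta> = - d" using that by (auto simp: field_simps)
        then have "(2 * x + \<theta>) ^ 2 = d ^ 2" by auto
        then show ?thesis unfolding d by (simp add: power2_eq_square algebra_simps)
      qed
      then have "x ^ 3 - of_int p * x - of_int q = 0"
        using th by algebra
      then show ?thesis using root by blast
    qed
    from this[of "(- \<theta> + d) / 2"] this[of "(- \<theta> - d) / 2"] have "\<theta> = 0" by simp
    then show False using irrational by simp
  qed
  then interpret complex_cubic p q \<theta>
    using irrational th by unfold_locales auto
  show ?thesis by (rule exists_peck_sequence)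
qed

end
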